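(* Let $\mathfrak N(M_2(\mathbb C))$ be the convex set of normalized unitarily invariant norms on $M_2(\mathbb C)$ and let $\mathfrak N_e(M_2(\mathbb C))$ be its set of extreme points. Then $\mathfrak N_e(M_2(\mathbb C))$ is exactly the set of norms $$T\mapsto\max\{t\|T\|,\ \|T\|_1\},\qquad \tfrac12\le t\le1,$$ where $\|T\|_1=\tau_2(|T|)$.
   Context: $\|\cdot\|$ is the operator norm, $\tau_2$ is the normalized trace on $M_2(\mathbb C)$, $|T|=(T^*T)^{1/2}$. A norm $|\!|\!|\cdot|\!|\!|$ is unitarily invariant if $|\!|\!|UTV|\!|\!|=|\!|\!|T|\!|\!|$ for all $T$ and unitary $U,V$, and normalized if $|\!|\!|1|\!|\!|=1$. *)

theory Defs
  imports "HOL-Analysis.Analysis" "HOL-Library.Function_Algebras"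
begin

text \<open>Pointwise real vector space structure on functions, so that \<^const>\<open>convex\<close> and
  \<^const>\<open>extreme_point_of\<close> apply to sets of norms.\<close>

instantiation "fun" :: (type, real_vector) real_vector
begin

definition scaleR_fun :: "real \<Rightarrow> ('a \<Rightarrow> 'b) \<Rightarrow> 'a \<Rightarrow> 'b"
  where "scaleR_fun r f = (\<lambda>x. r *\<^sub>R f x)"

instance
  by standard (simp_all add: scaleR_fun_def fun_eq_iff algebra_simps)

end

lemma scaleR_fun_apply [simp]: "(r *\<^sub>R f) x = r *\<^sub>R f x"
  by (simp add: scaleR_fun_def)

definition conj_transpose :: "complex^'n^'m \<Rightarrow> complex^'m^'n"
  where "conj_transpose A = (\<chi> i j. cnj (A $ j $ i))"

definition unitary_matrix :: "complex^'n^'n \<Rightarrow> bool"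
  where "unitary_matrix U \<longleftrightarrow>
    conj_transpose U ** U = mat 1 \<and> U ** conj_transpose U = mat 1"

text \<open>Over the complex numbers, a nonnegative quadratic form forces the matrix to be Hermitian.\<close>

definition pos_semidef :: "complex^'n^'n \<Rightarrow> bool"
  where "pos_semidef A \<longleftrightarrow> (\<forall>x. (\<Sum>i\<in>UNIV. cnj (x $ i) * (A *v x) $ i) \<in> \<real>\<^sub>\<ge>\<^sub>0)"

definition abs_matrix :: "complex^'n^'n \<Rightarrow> complex^'n^'n"
  where "abs_matrix T = (THE P. pos_semidef P \<and> P ** P = conj_transpose T ** T)"

definition normalized_trace :: "complex^'n^'n \<Rightarrow> complex"
  where "normalized_trace A = trace A / of_nat CARD('n)"

text \<open>The normalized trace of a positive semidefinite matrix is real, so \<^const>\<open>Re\<close> only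
  changes the type here.\<close>

definition trace_norm :: "complex^'n^'n \<Rightarrow> real"
  where "trace_norm T = Re (normalized_trace (abs_matrix T))"

text \<open>The norm on \<open>complex^'n\<close> is the Euclidean one.\<close>

definition operator_norm :: "complex^'n^'n \<Rightarrow> real"
  where "operator_norm T = onorm (\<lambda>x. T *v x)"

definition matrix_norm :: "(complex^'n^'n \<Rightarrow> real) \<Rightarrow> bool"
  where "matrix_norm N \<longleftrightarrow>
    (\<forall>A. 0 \<le> N A) \<and>
    (\<forall>A. N A = 0 \<longleftrightarrow> A = 0) \<and>
    (\<forall>c A. N (\<chi> i j. c * A $ i $ j) = cmod c * N A) \<and>
    (\<forall>A B. N (A + B) \<le> N A + N B)"

definition unitarily_invariant :: "(complex^'n^'n \<Rightarrow> real) \<Rightarrow> bool"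
  where "unitarily_invariant N \<longleftrightarrow>
    (\<forall>T U V. unitary_matrix U \<longrightarrow> unitary_matrix V \<longrightarrow> N (U ** T ** V) = N T)"

definition normalized_ui_norms :: "(complex^'n^'n \<Rightarrow> real) set"
  where "normalized_ui_norms = {N. matrix_norm N \<and> unitarily_invariant N \<and> N (mat 1) = 1}"

lemma convex_normalized_ui_norms:
  "convex (normalized_ui_norms :: (complex^'n^'n \<Rightarrow> real) set)"
proof (rule convexI)
  fix M N :: "complex^'n^'n \<Rightarrow> real" and u v :: real
  assume M: "M \<in> normalized_ui_norms" and N: "N \<in> normalized_ui_norms"
    and uv: "0 \<le> u" "0 \<le> v" "u + v = 1"
  have nonneg: "0 \<le> M A" "0 \<le> N A" and zero: "M A = 0 \<longleftrightarrow> A = 0" "N A = 0 \<longleftrightarrow> A = 0"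
    and tri: "M (A + B) \<le> M A + M B" "N (A + B) \<le> N A + N B" for A B
    using M N by (auto simp: normalized_ui_norms_def matrix_norm_def)
  have "u * M A + v * N A = 0 \<longleftrightarrow> A = 0" for A
    using nonneg[of A] zero[of A] uv
    by (auto simp: add_nonneg_eq_0_iff)
  moreover have "u * M (A + B) + v * N (A + B) \<le> u * M A + v * N A + (u * M B + v * N B)" for A B
    using mult_left_mono[OF tri(1)[of A B] uv(1)] mult_left_mono[OF tri(2)[of A B] uv(2)]
    by (simp add: algebra_simps)
  ultimately show "u *\<^sub>R M + v *\<^sub>R N \<in> normalized_ui_norms"
    using M N uv
    by (auto simp: normalized_ui_norms_def matrix_norm_def unitarily_invariant_def algebra_simps)
qed

end

theory Submission
  imports Defs
begin

text \<open>
  By the singular value decomposition a normalized unitarily invariant norm \<open>N\<close> on 2-by-2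
  matrices is determined by the one-variable function \<open>f x = N (diag (1, x))\<close> for
  \<open>0 \<le> x \<le> 1\<close>: a matrix with singular values \<open>a \<ge> b\<close> has norm \<open>a f (b / a)\<close>. This \<open>f\<close>, the
  profile of \<open>N\<close>, is convex and increasing with \<open>f 1 = 1\<close> and \<open>f x \<ge> (1 + x) / 2\<close>
  (\<open>profile_of_ui_norm\<close>). Conversely every such \<open>f\<close> is the profile of a norm
  (\<open>ui_norm_profile_norm\<close>): written in terms of \<open>\<alpha> = a\<close> and \<open>\<gamma> = a + b\<close>, which are the operator
  norm and twice the trace norm and so obey triangle inequalities, the expression
  \<open>a f (b / a) = \<alpha> f (\<gamma> / \<alpha> - 1)\<close> is positively homogeneous, convex, and increasing in both
  \<open>\<alpha>\<close> and \<open>\<gamma>\<close>. Since the correspondence is affine, it remains to find the extreme profiles.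

  The slopes of a profile increase from at least \<open>0\<close> to at most \<open>1/2\<close>, so an extreme profile
  should have only the slopes \<open>0\<close> and \<open>1/2\<close>, that is, be of the form \<open>max t ((1 + x) / 2)\<close>, which
  is the profile of the norm in the theorem. To avoid derivatives, let \<open>m\<close> be a point where the
  slope of \<open>f\<close> crosses \<open>1/4\<close>, i.e. a minimum point of \<open>f x - x / 4\<close>. Then \<open>f\<close> is the mean of two
  profiles: one has slope \<open>2 f'\<close> left of \<open>m\<close> and \<open>1/2\<close> right of it, the other has slope \<open>0\<close>
  left of \<open>m\<close> and \<open>2 f' - 1/2\<close> right of it (\<open>profile_split\<close>). If \<open>f\<close> is extreme, both equal
  \<open>f\<close>, which forces \<open>f\<close> to be constant left of \<open>m\<close> and equal to \<open>(1 + x) / 2\<close> right of it. In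
  the other direction, \<open>max t ((1 + x) / 2)\<close> attains the lower bound for profiles where it is not
  constant, and monotonicity prevents any decomposition where it is constant
  (\<open>profile_max_extreme\<close>).

  On the matrix side three facts are needed: the singular value decomposition (\<open>svd2\<close>), the
  uniqueness of positive square roots, which makes \<^const>\<open>abs_matrix\<close> computable
  (\<open>abs_matrix_svd\<close>), and the triangle inequality of the trace norm, which follows from
  \<open>Re (tr (U T V)) \<le> 2 \<parallel>T\<parallel>\<^sub>1\<close> for unitary \<open>U, V\<close> (\<open>Re_trace_le_trace_norm\<close>).
\<close>

section \<open>Hermitian inner product, unitary and positive semidefinite matrices\<close>

definition hinner :: "complex^'n \<Rightarrow> complex^'n \<Rightarrow> complex"
  where "hinner x y = (\<Sum>i\<in>UNIV. cnj (x $ i) * y $ i)"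

lemma hinner_add_left: "hinner (x + y) z = hinner x z + hinner y z"
  by (simp add: hinner_def algebra_simps sum.distrib)

lemma hinner_add_right: "hinner x (y + z) = hinner x y + hinner x z"
  by (simp add: hinner_def algebra_simps sum.distrib)

lemma hinner_scale_left: "hinner (c *s x) y = cnj c * hinner x y"
  by (simp add: hinner_def sum_distrib_left mult_ac)

lemma hinner_scale_right: "hinner x (c *s y) = c * hinner x y"
  by (simp add: hinner_def sum_distrib_left mult_ac)

lemma hinner_cnj: "cnj (hinner x y) = hinner y x"
  by (simp add: hinner_def mult_ac)

lemma hinner_self: "hinner x x = of_real ((norm x)\<^sup>2)"
  by (simp add: hinner_def norm_vec_def L2_set_def sum_nonneg complex_norm_square
      mult.commute[of "cnj _"] del: of_real_power)

lemma hinner_adjoint: "hinner x (A *v y) = hinner (conj_transpose A *v x) y"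
proof -
  have "hinner x (A *v y) = (\<Sum>i\<in>UNIV. \<Sum>j\<in>UNIV. cnj (x $ i) * A $ i $ j * y $ j)"
    by (simp add: hinner_def matrix_vector_mult_def sum_distrib_left mult.assoc)
  also have "\<dots> = (\<Sum>j\<in>UNIV. \<Sum>i\<in>UNIV. cnj (x $ i) * A $ i $ j * y $ j)"
    by (rule sum.swap)
  also have "\<dots> = hinner (conj_transpose A *v x) y"
    by (simp add: hinner_def matrix_vector_mult_def conj_transpose_def sum_distrib_left mult_ac)
  finally show ?thesis .
qed

lemma conj_transpose_mult: "conj_transpose (A ** B) = conj_transpose B ** conj_transpose A"
  by (simp add: conj_transpose_def matrix_matrix_mult_def vec_eq_iff mult.commute)

lemma conj_transpose_conj_transpose [simp]: "conj_transpose (conj_transpose A) = A"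
  by (simp add: conj_transpose_def vec_eq_iff)

lemma unitary_conj_transpose [simp]: "unitary_matrix (conj_transpose U) \<longleftrightarrow> unitary_matrix U"
  by (auto simp: unitary_matrix_def)

lemma unitary_mat_1 [simp]: "unitary_matrix (mat 1)"
proof -
  have "conj_transpose (mat 1) = (mat 1 :: complex^'n^'n)"
    by (auto simp: conj_transpose_def mat_def vec_eq_iff)
  then show "unitary_matrix (mat 1 :: complex^'n^'n)"
    by (simp add: unitary_matrix_def)
qed

lemma unitary_cancel:
  assumes "unitary_matrix U"
  shows "conj_transpose U ** (U ** A) = A" "U ** (conj_transpose U ** A) = A"
    "(B ** U) ** conj_transpose U = B" "(B ** conj_transpose U) ** U = B"
  using assms by (metis unitary_matrix_def matrix_mul_assoc matrix_mul_lid matrix_mul_rid)+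

lemma unitary_mult: "unitary_matrix U \<Longrightarrow> unitary_matrix V \<Longrightarrow> unitary_matrix (U ** V)"
  by (simp add: unitary_matrix_def[of "U ** V"] conj_transpose_mult unitary_cancel matrix_mul_assoc)
     (simp add: unitary_matrix_def)

lemma unitary_norm:
  assumes "unitary_matrix U"
  shows "norm (U *v x) = norm x"
proof -
  have "hinner (U *v x) (U *v x) = hinner x x"
    using assms by (simp add: hinner_adjoint matrix_vector_mul_assoc unitary_matrix_def)
  then have "(norm (U *v x))\<^sup>2 = (norm x)\<^sup>2"
    by (simp only: hinner_self of_real_eq_iff)
  then show ?thesis by simp
qed

lemma pos_semidef_hinner: "pos_semidef P \<longleftrightarrow> (\<forall>x. hinner x (P *v x) \<in> \<real>\<^sub>\<ge>\<^sub>0)"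
  by (simp add: pos_semidef_def hinner_def)

text \<open>Polarization: the quadratic form is real at \<open>x + y\<close> and at \<open>x + \<i> y\<close>, which pins down the
  imaginary and the real part of the form at \<open>(x, y)\<close>.\<close>

lemma pos_semidef_hermitian:
  assumes "pos_semidef P"
  shows "hinner x (P *v y) = hinner (P *v x) y"
proof -
  have im: "Im (hinner z (P *v z)) = 0" for z
    using assms by (metis pos_semidef_hinner nonneg_Reals_cases Im_complex_of_real)
  let ?a = "hinner x (P *v y)" and ?b = "hinner y (P *v x)"
  have "Im (?a + ?b) = 0"
    using im[of "x + y"] im[of x] im[of y]
    by (simp add: matrix_vector_right_distrib hinner_add_left hinner_add_right)
  moreover have "Im (\<i> * ?a - \<i> * ?b) = 0"
    using im[of "x + \<i> *s y"] im[of x] im[of "\<i> *s y"]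
    by (simp add: matrix_vector_right_distrib hinner_add_left hinner_add_right
        hinner_scale_left hinner_scale_right vector_scalar_commute)
  ultimately have "?a = cnj ?b"
    by (simp add: complex_eq_iff)
  then show ?thesis by (simp add: hinner_cnj)
qed

text \<open>The uniqueness of the positive square root, one eigenvector at a time. The vector
  \<open>y = P w - r w\<close> satisfies \<open>P y = - r y\<close>, so a positive \<open>r\<close> would make the quadratic form
  negative at a nonzero \<open>y\<close>; for \<open>r = 0\<close>, \<open>P w\<close> vanishes because \<open>P\<close> is Hermitian.\<close>

lemma pos_semidef_sqrt_eigenvector:
  assumes P: "pos_semidef P" and r: "0 \<le> r" and w: "P *v (P *v w) = of_real (r\<^sup>2) *s w"
  shows "P *v w = of_real r *s w"
proof -
  define y where "y = P *v w - of_real r *s w"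
  have "y = 0"
  proof (cases "r = 0")
    case True
    have "hinner (P *v w) (P *v w) = hinner w (P *v (P *v w))"
      using pos_semidef_hermitian[OF P, of w "P *v w"] by simp
    also have "\<dots> = 0" using w True by (simp add: hinner_def)
    finally show ?thesis using True by (simp add: hinner_self y_def)
  next
    case False
    have "P *v y = - (of_real r *s y)"
      using w by (simp add: y_def matrix_vector_mult_diff_distrib vector_scalar_commute
         vec_eq_iff algebra_simps power2_eq_square)
    then have "hinner y (P *v y) = - (of_real r * hinner y y)"
      by (simp add: hinner_def sum_negf sum_distrib_left mult_ac)
    then have "hinner y (P *v y) = of_real (- (r * (norm y)\<^sup>2))"
      by (simp add: hinner_self)
    then have "0 \<le> - (r * (norm y)\<^sup>2)"
      using P by (metis pos_semidef_hinner nonneg_Reals_of_real_iff)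
    then show ?thesis using False r
      by (simp add: mult_le_0_iff)
  qed
  then show ?thesis by (simp add: y_def)
qed

section \<open>Singular values of complex 2-by-2 matrices\<close>

definition diag2 :: "complex \<Rightarrow> complex \<Rightarrow> complex^2^2"
  where "diag2 a b = vector [vector [a, 0], vector [0, b]]"

lemma diag2_entries [simp]:
  "diag2 a b $ 1 $ 1 = a" "diag2 a b $ 1 $ 2 = 0" "diag2 a b $ 2 $ 1 = 0" "diag2 a b $ 2 $ 2 = b"
  by (simp_all add: diag2_def)

lemma matrix2_eqI:
  fixes A B :: "'a^2^2"
  assumes "A $ 1 $ 1 = B $ 1 $ 1" "A $ 1 $ 2 = B $ 1 $ 2" "A $ 2 $ 1 = B $ 2 $ 1" "A $ 2 $ 2 = B $ 2 $ 2"
  shows "A = B"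
  using assms by (simp add: vec_eq_iff forall_2)

lemma matrix2_mult_entry: "(A ** B) $ i $ j = A $ i $ 1 * B $ 1 $ j + A $ i $ 2 * B $ 2 $ j"
  for A B :: "complex^2^2"
  by (simp add: matrix_matrix_mult_def sum_2)

lemma matrix2_vector_entry: "(A *v x) $ i = A $ i $ 1 * x $ 1 + A $ i $ 2 * x $ 2"
  for A :: "complex^2^2"
  by (simp add: matrix_vector_mult_def sum_2)

lemma conj_transpose_entry [simp]: "conj_transpose A $ i $ j = cnj (A $ j $ i)"
  by (simp add: conj_transpose_def)

lemma diag2_mult: "diag2 a b ** diag2 c d = diag2 (a * c) (b * d)"
  by (rule matrix2_eqI) (simp_all add: matrix2_mult_entry)

lemma conj_transpose_diag2: "conj_transpose (diag2 a b) = diag2 (cnj a) (cnj b)"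
  by (rule matrix2_eqI) simp_all

lemma diag2_1: "diag2 1 1 = mat 1"
  by (rule matrix2_eqI) (simp_all add: mat_def)

lemma unitary_diag2: "cmod a = 1 \<Longrightarrow> cmod b = 1 \<Longrightarrow> unitary_matrix (diag2 a b)"
  by (simp add: unitary_matrix_def conj_transpose_diag2 diag2_mult flip: diag2_1)
     (metis complex_norm_square mult.commute of_real_1 power_one)

lemma norm_vec2: "(norm (x :: complex^2))\<^sup>2 = (cmod (x $ 1))\<^sup>2 + (cmod (x $ 2))\<^sup>2"
  by (simp add: norm_vec_def L2_set_def sum_2)

lemma unitary_with_first_column:
  fixes v :: "complex^2"
  assumes "norm v = 1"
  obtains V where "unitary_matrix V" "V *v axis 1 1 = v"
proof
  let ?V = "vector [vector [v $ 1, - cnj (v $ 2)], vector [v $ 2, cnj (v $ 1)]] :: complex^2^2"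
  have "(cmod (v $ 1))\<^sup>2 + (cmod (v $ 2))\<^sup>2 = 1"
    using assms by (simp flip: norm_vec2)
  then have "complex_of_real ((cmod (v $ 1))\<^sup>2 + (cmod (v $ 2))\<^sup>2) = 1"
    by (simp only: of_real_1)
  then have 1: "v $ 1 * cnj (v $ 1) + v $ 2 * cnj (v $ 2) = 1"
    by (simp only: of_real_add complex_norm_square)
  then have 2: "v $ 2 * cnj (v $ 2) + v $ 1 * cnj (v $ 1) = 1"
    by (simp only: add.commute)
  show "unitary_matrix ?V"
    unfolding unitary_matrix_def
    by (intro conjI matrix2_eqI)
       (use 1 2 in \<open>simp_all add: matrix2_mult_entry mat_def mult.commute\<close>)
  show "?V *v axis 1 1 = v"
    by (simp add: vec_eq_iff forall_2 matrix2_vector_entry axis_def)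
qed

text \<open>The first right singular vector \<open>v\<close> maximizes \<open>norm (T v)\<close> on the unit sphere. In bases that
  begin with \<open>v\<close> and with the direction of \<open>T v\<close> the matrix of \<open>T\<close> becomes upper triangular, and
  maximality makes it diagonal; a phase then turns the second diagonal entry nonnegative.\<close>

lemma svd2:
  fixes T :: "complex^2^2"
  obtains U V a b where "unitary_matrix U" "unitary_matrix V" "0 \<le> b" "b \<le> a"
    "T = U ** diag2 (of_real a) (of_real b) ** V"
proof -
  have "compact (sphere (0::complex^2) 1)" "sphere (0::complex^2) 1 \<noteq> {}"
    by simp_all
  moreover have "continuous_on (sphere (0::complex^2) 1) (\<lambda>x. norm (T *v x))"
    by (intro continuous_on_norm linear_continuous_on) simp
  ultimately obtain v where v: "norm v = 1" "\<And>x. norm x = 1 \<Longrightarrow> norm (T *v x) \<le> norm (T *v v)"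
    using continuous_attains_sup by (metis mem_sphere_0)
  define a where "a = norm (T *v v)"
  have bound: "norm (T *v x) \<le> a * norm x" for x
  proof (cases "x = 0")
    case False
    have "T *v (x /\<^sub>R norm x) = (T *v x) /\<^sub>R norm x"
      by (simp add: matrix_vector_mult_def vec_eq_iff scaleR_sum_right)
    with v(2)[of "x /\<^sub>R norm x"] False show ?thesis
      by (simp add: a_def field_simps)
  qed simp
  define u where "u = (if a = 0 then axis 1 1 else (T *v v) /\<^sub>R a)"
  have "norm u = 1" by (auto simp: u_def a_def)
  have Tv: "T *v v = of_real a *s u"
    by (auto simp: u_def a_def vec_eq_iff scaleR_conv_of_real[where 'a = complex])
  obtain U where U: "unitary_matrix U" "U *v axis 1 1 = u"
    using unitary_with_first_column[OF \<open>norm u = 1\<close>] .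
  obtain V where V: "unitary_matrix V" "V *v axis 1 1 = v"
    using unitary_with_first_column[OF v(1)] .
  define M where "M = conj_transpose U ** T ** V"
  have "M *v axis 1 1 = conj_transpose U *v (T *v (V *v axis 1 1))"
    by (simp add: M_def matrix_vector_mul_assoc matrix_mul_assoc)
  also have "\<dots> = of_real a *s (conj_transpose U *v (U *v axis 1 1))"
    by (simp add: V Tv vector_scalar_commute U)
  also have "\<dots> = of_real a *s axis 1 1"
    using U(1) by (simp add: matrix_vector_mul_assoc unitary_matrix_def)
  finally have M1: "M $ 1 $ 1 = of_real a" "M $ 2 $ 1 = 0"
    by (auto simp: vec_eq_iff forall_2 matrix2_vector_entry axis_def)
  have Mbound: "norm (M *v x) \<le> a * norm x" for x
  proof -
    have "M *v x = conj_transpose U *v (T *v (V *v x))"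
      by (simp add: M_def matrix_vector_mul_assoc matrix_mul_assoc)
    then have "norm (M *v x) = norm (T *v (V *v x))"
      using U(1) by (simp add: unitary_norm)
    then show ?thesis using bound[of "V *v x"] V(1) by (simp add: unitary_norm)
  qed
  define c where "c = M $ 1 $ 2"
  define d where "d = M $ 2 $ 2"
  have "c = 0"
  proof -
    (* The conjugate of the first row (a, c) is the vector that the first row stretches most, by
       the norm of that row, which exceeds the maximum a unless c = 0. *)
    define y :: "complex^2" where "y = vector [of_real a, cnj c]"
    define r where "r = (norm y)\<^sup>2"
    have r: "r = a\<^sup>2 + (cmod c)\<^sup>2"
      by (simp add: r_def y_def norm_vec2)
    have "(M *v y) $ 1 = of_real r"
      by (simp add: matrix2_vector_entry M1 y_def r power2_eq_square complex_norm_square flip: c_def)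
         (metis complex_norm_square power2_eq_square of_real_mult)
    then have "cmod ((M *v y) $ 1) = r" by (simp add: r_def del: of_real_power)
    then have "r \<le> a * norm y"
      using Mbound[of y] Finite_Cartesian_Product.norm_nth_le[of "M *v y" 1] by linarith
    then have "r\<^sup>2 \<le> a\<^sup>2 * r"
      using r by (metis r_def power_mult_distrib power_mono zero_le_power2)
    then have "r * (cmod c)\<^sup>2 \<le> 0"
      using r by (simp add: power2_eq_square algebra_simps)
    moreover have "0 \<le> r" by (simp add: r_def)
    ultimately have "r = 0 \<or> c = 0"
      by (auto simp: mult_le_0_iff)
    then show ?thesis using r
      by (auto simp: sum_power2_eq_zero_iff)
  qed
  have "cmod d \<le> a"
  proof -
    have "cmod ((M *v axis 2 1) $ 2) \<le> a"
      using Mbound[of "axis 2 1"] Finite_Cartesian_Product.norm_nth_le[of "M *v axis 2 1" 2] by simp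
    then show ?thesis by (simp add: matrix2_vector_entry d_def axis_def)
  qed
  define e where "e = (if d = 0 then 1 else d / of_real (cmod d))"
  have e: "cmod e = 1" "d = e * of_real (cmod d)"
    by (auto simp: e_def norm_divide)
  have "M = diag2 1 e ** diag2 (of_real a) (of_real (cmod d))"
    using M1 \<open>c = 0\<close> e(2) by (intro matrix2_eqI) (simp_all add: diag2_mult c_def d_def)
  moreover have "T = U ** M ** conj_transpose V"
    using U(1) V(1) by (simp add: M_def unitary_cancel flip: matrix_mul_assoc)
      (metis unitary_cancel matrix_mul_assoc)
  ultimately have "T = (U ** diag2 1 e) ** diag2 (of_real a) (of_real (cmod d)) ** conj_transpose V"
    by (simp add: matrix_mul_assoc)
  moreover have "unitary_matrix (U ** diag2 1 e)"
    using U e by (simp add: unitary_mult unitary_diag2)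
  ultimately show thesis
    using that \<open>cmod d \<le> a\<close> V(1) by (metis norm_ge_zero unitary_conj_transpose)
qed

lemma operator_norm_svd:
  assumes "unitary_matrix U" "unitary_matrix V" "0 \<le> b" "b \<le> a"
  shows "operator_norm (U ** diag2 (of_real a) (of_real b) ** V) = a"
proof -
  let ?D = "diag2 (of_real a) (of_real b)"
  let ?T = "U ** ?D ** V"
  have T: "norm (?T *v x) = norm (?D *v (V *v x))" for x
    using assms(1) by (metis unitary_norm matrix_vector_mul_assoc)
  have D: "norm (?D *v y) \<le> a * norm y" for y
  proof (rule power2_le_imp_le)
    have "(norm (?D *v y))\<^sup>2 = a\<^sup>2 * (cmod (y $ 1))\<^sup>2 + b\<^sup>2 * (cmod (y $ 2))\<^sup>2"
      by (simp add: norm_vec2 matrix2_vector_entry norm_mult power_mult_distrib)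
    also have "\<dots> \<le> a\<^sup>2 * (cmod (y $ 1))\<^sup>2 + a\<^sup>2 * (cmod (y $ 2))\<^sup>2"
      using assms by (intro add_left_mono mult_right_mono power_mono) auto
    finally show "(norm (?D *v y))\<^sup>2 \<le> (a * norm y)\<^sup>2"
      by (simp add: power_mult_distrib norm_vec2 distrib_left)
  qed (use assms in simp)
  show ?thesis
    unfolding operator_norm_def
  proof (rule antisym)
    show "onorm (\<lambda>x. ?T *v x) \<le> a"
      using T D assms by (intro onorm_le) (metis unitary_norm)
    define x where "x = conj_transpose V *v axis 1 1"
    have "V *v x = axis 1 1"
      using assms(2) by (simp add: x_def matrix_vector_mul_assoc unitary_matrix_def)
    then have "norm (?T *v x) = norm (?D *v axis 1 1)" by (simp add: T)
    also have "?D *v axis 1 1 = of_real a *s axis 1 1"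
      by (simp add: vec_eq_iff forall_2 matrix2_vector_entry axis_def)
    also have "norm \<dots> = a"
      using assms by (simp add: norm_vec_def L2_set_def sum_2 axis_def)
    finally have "a \<le> onorm (\<lambda>x. ?T *v x) * norm x"
      by (metis onorm matrix_vector_mul_bounded_linear)
    moreover have "norm x = 1"
      using assms(2) by (simp add: x_def unitary_norm)
    ultimately show "a \<le> onorm (\<lambda>x. ?T *v x)" by simp
  qed
qed

text \<open>Any positive square root of \<open>V\<^sup>* D\<^sup>2 V\<close> acts on the eigenbasis formed by the columns of
  \<open>V\<^sup>*\<close> as \<open>D\<close> prescribes, by \<open>pos_semidef_sqrt_eigenvector\<close>.\<close>

lemma abs_matrix_svd:
  assumes "unitary_matrix U" "unitary_matrix V" "0 \<le> a" "0 \<le> b"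
  shows "abs_matrix (U ** diag2 (of_real a) (of_real b) ** V) =
    conj_transpose V ** diag2 (of_real a) (of_real b) ** V"
proof -
  let ?D = "diag2 (of_real a) (of_real b)"
  let ?T = "U ** ?D ** V"
  let ?Q = "conj_transpose V ** ?D ** V"
  have TT: "conj_transpose ?T ** ?T = conj_transpose V ** (?D ** ?D) ** V"
    using assms(1) by (simp add: conj_transpose_mult conj_transpose_diag2 unitary_cancel
        flip: matrix_mul_assoc)
  have QQ: "?Q ** ?Q = conj_transpose V ** (?D ** ?D) ** V"
    using assms(2) by (simp add: unitary_cancel flip: matrix_mul_assoc)
  have psd: "pos_semidef ?Q"
    unfolding pos_semidef_hinner
  proof
    fix x
    have "hinner x (?Q *v x) = hinner (V *v x) (?D *v (V *v x))"
      by (simp add: hinner_adjoint flip: matrix_vector_mul_assoc)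
    also have "\<dots> = of_real (a * (cmod ((V *v x) $ 1))\<^sup>2 + b * (cmod ((V *v x) $ 2))\<^sup>2)"
      unfolding of_real_add of_real_mult complex_norm_square
      by (simp add: hinner_def sum_2 matrix2_vector_entry[of ?D] mult_ac)
    finally show "hinner x (?Q *v x) \<in> \<real>\<^sub>\<ge>\<^sub>0"
      using assms by (simp only: nonneg_Reals_of_real_iff) simp
  qed
  have uniq: "P = ?Q" if P: "pos_semidef P" "P ** P = conj_transpose V ** (?D ** ?D) ** V" for P
  proof -
    have VV: "V *v (conj_transpose V *v x) = x" for x
      using assms(2) by (simp add: matrix_vector_mul_assoc unitary_matrix_def)
    have eig: "P *v (conj_transpose V *v axis i 1) = of_real r *s (conj_transpose V *v axis i 1)"
      if D: "?D *v axis i 1 = of_real r *s axis i 1" and "0 \<le> r" for i r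
    proof (rule pos_semidef_sqrt_eigenvector[OF P(1) \<open>0 \<le> r\<close>])
      have "P *v (P *v (conj_transpose V *v axis i 1)) = (P ** P) *v (conj_transpose V *v axis i 1)"
        by (simp only: matrix_vector_mul_assoc matrix_mul_assoc)
      also have "\<dots> = conj_transpose V *v (?D *v (?D *v axis i 1))"
        by (simp only: P(2)) (simp add: VV flip: matrix_vector_mul_assoc)
      also have "\<dots> = of_real (r\<^sup>2) *s (conj_transpose V *v axis i 1)"
        by (simp add: D vector_scalar_commute power2_eq_square)
      finally show "P *v (P *v (conj_transpose V *v axis i 1)) = \<dots>" .
    qed
    have "P ** conj_transpose V = conj_transpose V ** ?D"
    proof -
      have D: "?D *v axis 1 1 = of_real a *s axis 1 1" "?D *v axis 2 1 = of_real b *s axis 2 1"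
        by (simp_all add: vec_eq_iff forall_2 matrix2_vector_entry axis_def)
      have "(P ** conj_transpose V) *v axis i 1 = (conj_transpose V ** ?D) *v axis i 1" for i
        using exhaust_2[of i] eig[OF D(1)] eig[OF D(2)] assms
        by (auto simp: D vector_scalar_commute simp flip: matrix_vector_mul_assoc)
      then show ?thesis
        by (simp add: vec_eq_iff matrix_vector_mult_def axis_def if_distrib cong: if_cong)
    qed
    then show ?thesis using assms(2) by (metis unitary_cancel(4))
  qed
  show ?thesis
    unfolding abs_matrix_def TT
    using psd QQ uniq by (intro the_equality conjI) (blast+)
qed

lemma trace_norm_svd:
  assumes "unitary_matrix U" "unitary_matrix V" "0 \<le> a" "0 \<le> b"
  shows "trace_norm (U ** diag2 (of_real a) (of_real b) ** V) = (a + b) / 2"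
proof -
  let ?D = "diag2 (of_real a) (of_real b)"
  have "trace (conj_transpose V ** ?D ** V) = trace (?D ** V ** conj_transpose V)"
    by (metis trace_mul_sym matrix_mul_assoc)
  also have "\<dots> = of_real (a + b)"
    using assms(2) by (simp add: unitary_cancel trace_def sum_2)
  finally show ?thesis
    using assms by (simp add: trace_norm_def normalized_trace_def abs_matrix_svd)
qed

section \<open>Triangle inequalities for the operator norm and the trace norm\<close>

lemma trace_norm_eq_Re_trace:
  assumes "unitary_matrix U" "unitary_matrix V" "0 \<le> a" "0 \<le> b" "T = U ** diag2 (of_real a) (of_real b) ** V"
  shows "2 * trace_norm T = Re (trace (conj_transpose U ** T ** conj_transpose V))"
proof -
  have "conj_transpose U ** T ** conj_transpose V = diag2 (of_real a) (of_real b)"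
    using assms by (simp add: unitary_cancel flip: matrix_mul_assoc)
      (metis matrix_mul_rid unitary_matrix_def)
  then show ?thesis
    using assms by (simp add: trace_norm_svd trace_def sum_2)
qed

lemma unitary_entry_le_1:
  assumes "unitary_matrix W"
  shows "cmod (W $ i $ j) \<le> 1"
proof -
  have "W $ i $ j = (W *v axis j 1) $ i"
    by (simp add: matrix_vector_mult_def axis_def if_distrib cong: if_cong)
  also have "cmod \<dots> \<le> norm (W *v axis j 1)" by (rule Finite_Cartesian_Product.norm_nth_le)
  also have "\<dots> = 1" using assms by (simp add: unitary_norm)
  finally show ?thesis .
qed

text \<open>With \<open>T = P diag(a, b) Q\<close> the trace is \<open>w\<^sub>1 a + w\<^sub>2 b\<close>, where \<open>w\<^sub>1, w\<^sub>2\<close> are the diagonal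
  entries of the unitary matrix \<open>Q V U P\<close> and have modulus at most \<open>1\<close>.\<close>

lemma Re_trace_le_trace_norm:
  fixes T :: "complex^2^2"
  assumes "unitary_matrix U" "unitary_matrix V"
  shows "Re (trace (U ** T ** V)) \<le> 2 * trace_norm T"
proof -
  obtain P Q a b where svd: "unitary_matrix P" "unitary_matrix Q" "0 \<le> b" "b \<le> a"
    "T = P ** diag2 (of_real a) (of_real b) ** Q"
    by (rule svd2)
  define W where "W = Q ** V ** U ** P"
  have W: "unitary_matrix W" using assms svd by (simp add: W_def unitary_mult)
  have "trace (U ** T ** V) = trace ((U ** P ** diag2 (of_real a) (of_real b)) ** (Q ** V))"
    by (simp add: svd(5) matrix_mul_assoc)
  also have "\<dots> = trace ((Q ** V) ** (U ** P ** diag2 (of_real a) (of_real b)))"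
    by (rule trace_mul_sym)
  also have "\<dots> = W $ 1 $ 1 * of_real a + W $ 2 $ 2 * of_real b"
    by (simp add: W_def matrix_mul_assoc trace_def sum_2 matrix2_mult_entry[of _ "diag2 _ _"])
  finally have "Re (trace (U ** T ** V)) = Re (W $ 1 $ 1) * a + Re (W $ 2 $ 2) * b"
    by simp
  also have "\<dots> \<le> 1 * a + 1 * b"
    using svd by (intro add_mono mult_right_mono order_trans[OF complex_Re_le_cmod] unitary_entry_le_1[OF W]) auto
  finally show ?thesis using svd by (simp add: trace_norm_svd)
qed

text \<open>The singular vectors of \<open>A + B\<close> turn its trace norm into a trace, which is additive, and the
  two summands are bounded by \<open>Re_trace_le_trace_norm\<close>.\<close>

lemma trace_norm_triangle:
  fixes A B :: "complex^2^2"
  shows "trace_norm (A + B) \<le> trace_norm A + trace_norm B"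
proof -
  obtain U V a b where svd: "unitary_matrix U" "unitary_matrix V" "0 \<le> b" "b \<le> a"
    "A + B = U ** diag2 (of_real a) (of_real b) ** V"
    by (rule svd2)
  have "conj_transpose U ** (A + B) ** conj_transpose V =
      conj_transpose U ** A ** conj_transpose V + conj_transpose U ** B ** conj_transpose V"
    by (simp add: matrix_add_ldistrib matrix_matrix_mult_def vec_eq_iff algebra_simps sum.distrib)
  then have "2 * trace_norm (A + B) = Re (trace (conj_transpose U ** A ** conj_transpose V))
      + Re (trace (conj_transpose U ** B ** conj_transpose V))"
    using trace_norm_eq_Re_trace[OF svd(1,2) _ svd(3,5)] svd by (simp add: trace_add)
  also have "\<dots> \<le> 2 * trace_norm A + 2 * trace_norm B"
    using svd by (intro add_mono Re_trace_le_trace_norm) auto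
  finally show ?thesis by simp
qed

lemma operator_norm_triangle: "operator_norm (A + B) \<le> operator_norm A + operator_norm B"
  for A B :: "complex^'n^'n"
  unfolding operator_norm_def matrix_vector_mult_add_rdistrib
  by (intro onorm_triangle) auto

section \<open>Profiles\<close>

text \<open>The functions \<open>x \<mapsto> N (diag (1, x))\<close> on \<open>[0, 1]\<close> that arise from normalized unitarily invariant
  norms \<open>N\<close>. Values outside \<open>[0, 1]\<close> carry no information.\<close>

definition profile :: "(real \<Rightarrow> real) \<Rightarrow> bool"
  where "profile f \<longleftrightarrow> convex_on {0..1} f \<and> mono_on {0..1} f \<and> f 1 = 1 \<and>
    (\<forall>x\<in>{0..1}. (1 + x) / 2 \<le> f x)"

lemma profile_lower: "profile f \<Longrightarrow> 0 \<le> x \<Longrightarrow> x \<le> 1 \<Longrightarrow> (1 + x) / 2 \<le> f x"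
  by (simp add: profile_def)

lemma profile_mono: "profile f \<Longrightarrow> 0 \<le> x \<Longrightarrow> x \<le> y \<Longrightarrow> y \<le> 1 \<Longrightarrow> f x \<le> f y"
  unfolding profile_def by (auto intro: mono_onD)

lemma profile_convex:
  assumes "profile f" "0 \<le> u" "0 \<le> v" "u + v = 1" "x \<in> {0..1}" "y \<in> {0..1}"
  shows "f (u * x + v * y) \<le> u * f x + v * f y"
  using assms by (auto simp: profile_def convex_on_def)

text \<open>The quotient \<open>f x / (1 + x)\<close> is at least \<open>1/2\<close>, with equality at \<open>x = 1\<close>, and by
  convexity \<open>f\<close> lies below its chords to that end. This is what makes the norm increase with the
  operator norm when the trace norm is fixed.\<close>

lemma profile_ratio_antimono:
  assumes f: "profile f" and xy: "0 \<le> y" "y \<le> x" "x \<le> 1"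
  shows "f x * (1 + y) \<le> f y * (1 + x)"
proof (cases "y = 1")
  case False
  define s where "s = (x - y) / (1 - y)"
  have s: "0 \<le> s" "s \<le> 1" "s * (1 - y) = x - y"
    using xy False by (auto simp: s_def divide_le_eq_1)
  then have x: "x = (1 - s) * y + s * 1"
    by (simp add: algebra_simps)
  have "f x \<le> (1 - s) * f y + s * f 1"
    using profile_convex[OF f, of "1 - s" s y 1] s xy unfolding x by simp
  also have "f 1 = 1" using f by (simp add: profile_def)
  finally have "f x * (1 + y) \<le> ((1 - s) * f y + s) * (1 + y)"
    using xy by (intro mult_right_mono) auto
  also have "s * (1 + y) \<le> s * (2 * f y)"
    using profile_lower[OF f, of y] xy s by (intro mult_left_mono) auto
  then have "((1 - s) * f y + s) * (1 + y) \<le> (1 - s) * f y * (1 + y) + s * (2 * f y)"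
    by (simp add: algebra_simps)
  also have "\<dots> = f y * (1 + x)"
    by (simp add: x algebra_simps)
  finally show ?thesis .
qed (use xy in simp)

text \<open>Here \<open>a, c\<close> stand for the operator norm and twice the trace norm of a matrix, hence the cone
  \<open>a \<le> c \<le> 2 a\<close>. If the argument of \<open>f\<close> increases, monotonicity of \<open>f\<close> is enough; if it
  decreases, one rewrites \<open>a f x\<close> as \<open>c (f x / (1 + x))\<close>.\<close>

lemma profile_perspective_mono:
  assumes f: "profile f" and "0 < a" "a \<le> c" "c \<le> 2 * a" "a \<le> a'" "c \<le> c'" "a' \<le> c'" "c' \<le> 2 * a'"
  shows "a * f (c / a - 1) \<le> a' * f (c' / a' - 1)"
proof -
  define x where "x = c / a - 1"
  define y where "y = c' / a' - 1"
  have xy: "0 \<le> x" "x \<le> 1" "0 \<le> y" "y \<le> 1" and c: "c = a * (1 + x)" "c' = a' * (1 + y)"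
    using assms by (auto simp: x_def y_def field_simps)
  have fpos: "0 < f x" "0 < f y"
    using profile_lower[OF f, of x] profile_lower[OF f, of y] xy by auto
  have "a * f x \<le> a' * f y"
  proof (cases "x \<le> y")
    case True
    then show ?thesis
      using profile_mono[OF f, of x y] xy assms fpos by (intro mult_mono) auto
  next
    case False
    have "(a * f x) * (1 + y) = a * (f x * (1 + y))" by simp
    also have "\<dots> \<le> a * (f y * (1 + x))"
      using profile_ratio_antimono[OF f, of y x] xy False assms by (intro mult_left_mono) auto
    also have "\<dots> = c * f y" by (simp add: c)
    also have "\<dots> \<le> c' * f y" using assms fpos by (intro mult_right_mono) auto
    also have "\<dots> = (a' * f y) * (1 + y)" by (simp add: c)
    finally show ?thesis using xy by simp
  qed
  then show ?thesis by (simp add: x_def y_def)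
qed

lemma profile_perspective_add:
  assumes f: "profile f" and "0 < a" "a \<le> c" "c \<le> 2 * a" "0 < a'" "a' \<le> c'" "c' \<le> 2 * a'"
  shows "(a + a') * f ((c + c') / (a + a') - 1) \<le> a * f (c / a - 1) + a' * f (c' / a' - 1)"
proof -
  define x where "x = c / a - 1"
  define y where "y = c' / a' - 1"
  have xy: "x \<in> {0..1}" "y \<in> {0..1}" and c: "c = a * (1 + x)" "c' = a' * (1 + y)"
    using assms by (auto simp: x_def y_def field_simps)
  define u where "u = a / (a + a')"
  define v where "v = a' / (a + a')"
  have uv: "0 \<le> u" "0 \<le> v" "u + v = 1" "(a + a') * u = a" "(a + a') * v = a'"
    using assms by (auto simp: u_def v_def simp flip: add_divide_distrib)
  have "c + c' = (a + a') + ((a + a') * u) * x + ((a + a') * v) * y"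
    unfolding uv(4,5) by (simp add: c algebra_simps)
  also have "\<dots> = (a + a') * (1 + (u * x + v * y))"
    by (simp add: algebra_simps)
  finally have eq: "(c + c') / (a + a') - 1 = u * x + v * y"
    using assms by simp
  have "(a + a') * f ((c + c') / (a + a') - 1) \<le> (a + a') * (u * f x + v * f y)"
    unfolding eq using profile_convex[OF f uv(1-3) xy] assms by (intro mult_left_mono) auto
  also have "\<dots> = ((a + a') * u) * f x + ((a + a') * v) * f y"
    by (simp add: algebra_simps)
  finally show ?thesis by (simp add: uv x_def y_def)
qed

lemma profile_max:
  assumes "1/2 \<le> t" "t \<le> 1"
  shows "profile (\<lambda>x. max t ((1 + x) / 2))"
  unfolding profile_def
proof (intro conjI)
  show "convex_on {0..1} (\<lambda>x. max t ((1 + x) / 2))"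
  proof (rule convex_onI)
    fix s x y :: real
    assume s: "0 < s" "s < 1"
    define p q where "p = max t ((1 + x) / 2)" and "q = max t ((1 + y) / 2)"
    have "(1 - s) * t + s * t \<le> (1 - s) * p + s * q"
      "(1 - s) * ((1 + x) / 2) + s * ((1 + y) / 2) \<le> (1 - s) * p + s * q"
      using s by (intro add_mono mult_left_mono; simp add: p_def q_def)+
    then have "max t ((1 + ((1 - s) *\<^sub>R x + s *\<^sub>R y)) / 2) \<le> (1 - s) * p + s * q"
      by (intro max.boundedI) (simp_all add: field_simps)
    then show "max t ((1 + ((1 - s) *\<^sub>R x + s *\<^sub>R y)) / 2)
        \<le> (1 - s) * max t ((1 + x) / 2) + s * max t ((1 + y) / 2)"
      by (simp only: p_def q_def)
  qed simp
  show "mono_on {0..1} (\<lambda>x. max t ((1 + x) / 2))"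
    by (intro mono_onI max.mono) auto
qed (use assms in auto)

text \<open>Where \<open>max t ((1 + x) / 2)\<close> equals \<open>(1 + x) / 2\<close>, both components attain their common lower
  bound. To the left of \<open>2 t - 1\<close> it is constant, so the two increasing components are constant
  as well.\<close>

lemma profile_max_extreme:
  assumes f: "profile f" and g: "profile g" and u: "0 < u" "u < 1" and t: "1/2 \<le> t" "t \<le> 1"
    and eq: "\<And>x. x \<in> {0..1} \<Longrightarrow> max t ((1 + x) / 2) = (1 - u) * f x + u * g x"
    and x: "x \<in> {0..1}"
  shows "f x = g x"
proof -
  (* If both components of a proper convex combination can only grow and the combination does not,
     then neither component grows. *)
  have rigid: "p = p' \<and> q = q'"
    if "p \<le> p'" "q \<le> q'" "(1 - u) * p + u * q = (1 - u) * p' + u * q'" for p p' q q' :: real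
  proof -
    have "(1 - u) * p \<le> (1 - u) * p'" "u * q \<le> u * q'"
      using that u by (auto intro: mult_left_mono)
    then have "(1 - u) * p = (1 - u) * p'" "u * q = u * q'"
      using that(3) by linarith+
    then show ?thesis using u by simp
  qed
  have upper: "f y = (1 + y) / 2 \<and> g y = (1 + y) / 2" if "2 * t - 1 \<le> y" "y \<in> {0..1}" for y
  proof -
    have "(1 - u) * ((1 + y) / 2) + u * ((1 + y) / 2) = (1 - u) * f y + u * g y"
      using eq[OF that(2)] that by (simp add: field_simps)
    then show ?thesis
      using rigid[of "(1 + y) / 2" "f y" "(1 + y) / 2" "g y"] profile_lower[OF f, of y]
        profile_lower[OF g, of y] that by auto
  qed
  show ?thesis
  proof (cases "2 * t - 1 \<le> x")
    case True
    then show ?thesis using upper x by metis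
  next
    case False
    let ?z = "2 * t - 1"
    have z: "?z \<in> {0..1}" using t by auto
    have "(1 - u) * f x + u * g x = (1 - u) * f ?z + u * g ?z"
      using eq[OF x] eq[OF z] False by (simp add: field_simps)
    moreover have "f x \<le> f ?z" "g x \<le> g ?z"
      using profile_mono[OF f, of x ?z] profile_mono[OF g, of x ?z] False x z by auto
    ultimately have "f x = f ?z \<and> g x = g ?z" by (intro rigid)
    then show ?thesis using upper[OF order_refl z] by simp
  qed
qed

lemma convex_on_mono_right_of_min:
  fixes h :: "real \<Rightarrow> real"
  assumes h: "convex_on {0..1} h" and m: "m \<in> {0..1}" "\<And>x. x \<in> {0..1} \<Longrightarrow> h m \<le> h x"
    and xy: "m \<le> x" "x \<le> y" "y \<le> 1"
  shows "h x \<le> h y"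
proof (cases "m = y")
  case False
  define s where "s = (x - m) / (y - m)"
  have s: "0 \<le> s" "s \<le> 1" and sx: "s * (y - m) = x - m"
    using xy False by (auto simp: s_def divide_le_eq_1)
  then have x: "x = (1 - s) * m + s * y"
    by (simp add: algebra_simps)
  have "h x \<le> (1 - s) * h m + s * h y"
    using convex_onD[OF h s, of m y] m xy unfolding x by simp
  also have "\<dots> \<le> (1 - s) * h y + s * h y"
    using m(2)[of y] m(1) xy s by (intro add_right_mono mult_left_mono) auto
  finally show ?thesis by (simp add: algebra_simps)
qed (use xy in simp)

lemma convex_on_antimono_left_of_min:
  fixes h :: "real \<Rightarrow> real"
  assumes h: "convex_on {0..1} h" and m: "m \<in> {0..1}" "\<And>x. x \<in> {0..1} \<Longrightarrow> h m \<le> h x"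
    and xy: "0 \<le> x" "x \<le> y" "y \<le> m"
  shows "h y \<le> h x"
proof (cases "m = x")
  case False
  define s where "s = (m - y) / (m - x)"
  have s: "0 \<le> s" "s \<le> 1" and sy: "s * (m - x) = m - y"
    using xy False by (auto simp: s_def divide_le_eq_1)
  then have y: "y = (1 - s) * m + s * x"
    by (simp add: algebra_simps)
  have "h y \<le> (1 - s) * h m + s * h x"
    using convex_onD[OF h s, of m x] m xy unfolding y by simp
  also have "\<dots> \<le> (1 - s) * h x + s * h x"
    using m(2)[of x] m(1) xy s by (intro add_right_mono mult_left_mono) auto
  finally show ?thesis by (simp add: algebra_simps)
qed (use xy in simp)

text \<open>The average of these two profiles is \<open>f\<close>. The function \<open>h\<close> has slope \<open>2 f' - 1/2\<close> and is
  convex with minimum at \<open>m\<close>, so it decreases before \<open>m\<close> and increases after it; the profiles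
  retain one of these two branches each.\<close>

lemma profile_split:
  assumes f: "profile f" and m: "m \<in> {0..1}"
    and min: "\<And>x. x \<in> {0..1} \<Longrightarrow> 2 * f m - (1 + m) / 2 \<le> 2 * f x - (1 + x) / 2"
  defines "h \<equiv> \<lambda>x. 2 * f x - (1 + x) / 2"
  shows "profile (\<lambda>x. (1 + x) / 2 + h (min x m) - h m)" "profile (\<lambda>x. h (max x m))"
proof -
  have f1: "f 1 = 1" using f by (simp add: profile_def)
  have hmin: "h m \<le> h x" if "x \<in> {0..1}" for x using min[OF that] by (simp add: h_def)
  have h: "convex_on {0..1} h"
  proof (rule convex_onI)
    fix s x y :: real
    assume "0 < s" "s < 1" "x \<in> {0..1}" "y \<in> {0..1}"
    then have "f ((1 - s) * x + s * y) \<le> (1 - s) * f x + s * f y"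
      by (intro profile_convex[OF f]) auto
    then show "h ((1 - s) *\<^sub>R x + s *\<^sub>R y) \<le> (1 - s) * h x + s * h y"
      by (simp add: h_def field_simps)
  qed simp
  have convex_same: "(1 - s) * z + s * z = z" for s z :: real
    by (simp add: algebra_simps)
  note up = convex_on_mono_right_of_min[OF h m hmin]
  note down = convex_on_antimono_left_of_min[OF h m hmin]
  have hlow: "(1 + x) / 2 \<le> h x" if "x \<in> {0..1}" for x
    using profile_lower[OF f, of x] that by (simp add: h_def field_simps)
  show "profile (\<lambda>x. h (max x m))"
    unfolding profile_def
  proof (intro conjI ballI)
    show "convex_on {0..1} (\<lambda>x. h (max x m))"
    proof (rule convex_onI)
      fix s x y :: real
      assume s: "0 < s" "s < 1" and xy: "x \<in> {0..1}" "y \<in> {0..1}"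
      have le: "(1 - s) * x + s * y \<le> (1 - s) * max x m + s * max y m"
        "(1 - s) * m + s * m \<le> (1 - s) * max x m + s * max y m"
        "(1 - s) * max x m + s * max y m \<le> (1 - s) * 1 + s * 1"
        using s xy m by (intro add_mono mult_left_mono; simp)+
      have "h (max ((1 - s) * x + s * y) m) \<le> h ((1 - s) * max x m + s * max y m)"
        by (intro up) (use le in \<open>simp_all add: convex_same\<close>)
      also have "\<dots> \<le> (1 - s) * h (max x m) + s * h (max y m)"
        using convex_onD[OF h, of s "max x m" "max y m"] s xy m by auto
      finally show "h (max ((1 - s) *\<^sub>R x + s *\<^sub>R y) m) \<le> (1 - s) * h (max x m) + s * h (max y m)"
        by simp
    qed simp
    show "mono_on {0..1} (\<lambda>x. h (max x m))"
      using m by (auto simp: mono_on_def intro!: up)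
    show "h (max 1 m) = 1" using m by (simp add: h_def f1)
    fix x :: real assume "x \<in> {0..1}"
    then have "(1 + max x m) / 2 \<le> h (max x m)"
      using m by (intro hlow) auto
    then show "(1 + x) / 2 \<le> h (max x m)"
      by (rule order_trans[rotated]) simp
  qed
  show "profile (\<lambda>x. (1 + x) / 2 + h (min x m) - h m)"
    unfolding profile_def
  proof (intro conjI ballI)
    show "convex_on {0..1} (\<lambda>x. (1 + x) / 2 + h (min x m) - h m)"
    proof (rule convex_onI)
      fix s x y :: real
      assume s: "0 < s" "s < 1" and xy: "x \<in> {0..1}" "y \<in> {0..1}"
      have le: "(1 - s) * min x m + s * min y m \<le> (1 - s) * x + s * y"
        "(1 - s) * min x m + s * min y m \<le> (1 - s) * m + s * m"
        "(1 - s) * 0 + s * 0 \<le> (1 - s) * min x m + s * min y m"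
        using s xy m by (intro add_mono mult_left_mono; simp)+
      have "h (min ((1 - s) * x + s * y) m) \<le> h ((1 - s) * min x m + s * min y m)"
        by (intro down) (use le in \<open>simp_all add: convex_same\<close>)
      also have "\<dots> \<le> (1 - s) * h (min x m) + s * h (min y m)"
        using convex_onD[OF h, of s "min x m" "min y m"] s xy m by auto
      finally show "(1 + ((1 - s) *\<^sub>R x + s *\<^sub>R y)) / 2 + h (min ((1 - s) *\<^sub>R x + s *\<^sub>R y) m) - h m
          \<le> (1 - s) * ((1 + x) / 2 + h (min x m) - h m) + s * ((1 + y) / 2 + h (min y m) - h m)"
        by (simp add: field_simps)
    qed simp
    show "mono_on {0..1} (\<lambda>x. (1 + x) / 2 + h (min x m) - h m)"
    proof (rule mono_onI)
      fix x y :: real assume xy: "x \<in> {0..1}" "y \<in> {0..1}" "x \<le> y"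
      have "f (min x m) \<le> f (min y m)"
        using xy m by (intro profile_mono[OF f]) auto
      then show "(1 + x) / 2 + h (min x m) - h m \<le> (1 + y) / 2 + h (min y m) - h m"
        using xy(3) by (auto simp: h_def min_def field_simps split: if_splits)
    qed
    show "(1 + 1) / 2 + h (min 1 m) - h m = 1" using m by simp
    fix x :: real assume "x \<in> {0..1}"
    then have "h m \<le> h (min x m)"
      using m by (intro hmin) auto
    then show "(1 + x) / 2 \<le> (1 + x) / 2 + h (min x m) - h m"
      by (simp add: field_simps)
  qed
qed

section \<open>Profiles and unitarily invariant norms correspond\<close>

text \<open>A matrix with singular values \<open>a \<ge> b\<close> receives the value \<open>a f (b / a)\<close>, see
  \<open>profile_norm_svd\<close>; the formula avoids naming the singular values. At \<open>T = 0\<close> the factor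
  \<open>operator_norm T\<close> vanishes, whatever the quotient and \<open>f\<close> yield there.\<close>

definition profile_norm :: "(real \<Rightarrow> real) \<Rightarrow> complex^2^2 \<Rightarrow> real"
  where "profile_norm f T = operator_norm T * f (2 * trace_norm T / operator_norm T - 1)"

lemma profile_norm_svd:
  assumes "unitary_matrix U" "unitary_matrix V" "0 \<le> b" "b \<le> a"
  shows "profile_norm f (U ** diag2 (of_real a) (of_real b) ** V) = a * f (b / a)"
proof (cases "a = 0")
  case False
  then have "2 * ((a + b) / 2) / a - 1 = b / a" by (simp add: field_simps)
  moreover have "0 \<le> a" using assms by simp
  ultimately show ?thesis
    using assms by (simp only: profile_norm_def operator_norm_svd trace_norm_svd)
qed (use assms operator_norm_svd[of U V 0 0] in \<open>simp add: profile_norm_def\<close>)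

lemma profile_norm_diag2:
  assumes "0 \<le> x" "x \<le> 1"
  shows "profile_norm f (diag2 1 (of_real x)) = f x"
  using profile_norm_svd[of "mat 1" "mat 1" x 1 f] assms by simp

lemma profile_norm_eqI:
  assumes "\<And>x. x \<in> {0..1} \<Longrightarrow> f x = g x"
  shows "profile_norm f = profile_norm g"
proof
  fix T
  obtain U V a b where svd: "unitary_matrix U" "unitary_matrix V" "0 \<le> b" "b \<le> a"
    "T = U ** diag2 (of_real a) (of_real b) ** V"
    by (rule svd2)
  have "b / a \<in> {0..1}" using svd(3,4) by (auto simp: divide_le_eq_1)
  then show "profile_norm f T = profile_norm g T"
    using svd assms by (simp add: profile_norm_svd)
qed

text \<open>Homogeneity and invariance hold because scaling and unitary factors change a singular value
  decomposition in an obvious way. The triangle inequality combines those of the operator norm and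
  the trace norm with monotonicity and subadditivity of \<open>(a, c) \<mapsto> a f (c / a - 1)\<close>.\<close>

lemma ui_norm_profile_norm:
  assumes f: "profile f"
  shows "profile_norm f \<in> normalized_ui_norms"
proof -
  have fpos: "0 < f x" if "x \<in> {0..1}" for x
    using profile_lower[OF f, of x] that by auto
  have ratio: "b / a \<in> {0..1}" if "0 \<le> b" "b \<le> a" for a b :: real
    using that by (auto simp: divide_le_eq_1)
  have nonneg: "0 \<le> profile_norm f T" and zero: "profile_norm f T = 0 \<longleftrightarrow> T = 0"
    and range: "0 \<le> operator_norm T" "operator_norm T \<le> 2 * trace_norm T"
      "2 * trace_norm T \<le> 2 * operator_norm T"
    and op0: "operator_norm T = 0 \<Longrightarrow> T = 0"
    and scale: "profile_norm f (\<chi> i j. c * T $ i $ j) = cmod c * profile_norm f T"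
    and inv: "unitary_matrix P \<Longrightarrow> unitary_matrix Q \<Longrightarrow> profile_norm f (P ** T ** Q) = profile_norm f T"
    for T P Q c
  proof -
    obtain U V a b where svd: "unitary_matrix U" "unitary_matrix V" "0 \<le> b" "b \<le> a"
      and T: "T = U ** diag2 (of_real a) (of_real b) ** V"
      by (rule svd2)
    note N = profile_norm_svd[OF svd, of f]
    have fb: "0 < f (b / a)" using fpos ratio svd by blast
    have a0: "T = 0" if "a = 0"
      using that svd(3,4) T by (intro matrix2_eqI) (simp_all add: matrix2_mult_entry)
    show "0 \<le> profile_norm f T" using fb svd by (simp add: T N)
    show "profile_norm f T = 0 \<longleftrightarrow> T = 0"
    proof
      assume "profile_norm f T = 0"
      then show "T = 0" using fb a0 by (simp add: T N)
    next
      assume "T = 0"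
      then show "profile_norm f T = 0"
        by (simp add: profile_norm_def operator_norm_def onorm_zero)
    qed
    show "0 \<le> operator_norm T" "operator_norm T \<le> 2 * trace_norm T"
      "2 * trace_norm T \<le> 2 * operator_norm T"
      using svd by (simp_all add: T operator_norm_svd trace_norm_svd)
    show "T = 0" if "operator_norm T = 0"
      using that svd a0 by (simp add: T operator_norm_svd)
    show "profile_norm f (P ** T ** Q) = profile_norm f T"
      if "unitary_matrix P" "unitary_matrix Q" for P Q
    proof -
      have "P ** T ** Q = (P ** U) ** diag2 (of_real a) (of_real b) ** (V ** Q)"
        by (simp add: T matrix_mul_assoc)
      then show ?thesis
        using that svd N by (simp add: T profile_norm_svd unitary_mult)
    qed
    show "profile_norm f (\<chi> i j. c * T $ i $ j) = cmod c * profile_norm f T"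
    proof (cases "c = 0")
      case True
      then show ?thesis
        by (simp add: profile_norm_def operator_norm_def onorm_zero flip: zero_vec_def)
    next
      case False
      define w where "w = c / of_real (cmod c)"
      have w: "unitary_matrix (diag2 w w)"
        using False by (simp add: w_def unitary_diag2 norm_divide)
      have "(\<chi> i j. c * T $ i $ j) =
          (diag2 w w ** U) ** diag2 (of_real (cmod c * a)) (of_real (cmod c * b)) ** V"
        using False unfolding T w_def
        by (intro matrix2_eqI) (auto simp: matrix2_mult_entry algebra_simps)
      then have "profile_norm f (\<chi> i j. c * T $ i $ j) = (cmod c * a) * f (cmod c * b / (cmod c * a))"
        using w svd by (simp add: profile_norm_svd unitary_mult mult_left_mono del: of_real_mult)
      then show ?thesis using False by (simp add: T N)
    qed
  qed
  have triangle: "profile_norm f (A + B) \<le> profile_norm f A + profile_norm f B" for A B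
  proof -
    consider "A = 0" | "B = 0" | "A + B = 0" | "A \<noteq> 0" "B \<noteq> 0" "A + B \<noteq> 0" by blast
    then show ?thesis
    proof cases
      case 3
      then have "profile_norm f (A + B) = 0" using zero by blast
      then show ?thesis using nonneg[of A] nonneg[of B] by linarith
    next
      case 4
      then have pos: "0 < operator_norm A" "0 < operator_norm B" "0 < operator_norm (A + B)"
        using op0 range(1) by (metis order_le_less)+
      have "profile_norm f (A + B) \<le> (operator_norm A + operator_norm B) *
          f ((2 * trace_norm A + 2 * trace_norm B) / (operator_norm A + operator_norm B) - 1)"
        unfolding profile_norm_def
        using pos range[of A] range[of B] range[of "A + B"] operator_norm_triangle[of A B]
          trace_norm_triangle[of A B]
        by (intro profile_perspective_mono[OF f]) auto
      also have "\<dots> \<le> profile_norm f A + profile_norm f B"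
        unfolding profile_norm_def
        using pos range[of A] range[of B] by (intro profile_perspective_add[OF f]) auto
      finally show ?thesis .
    qed (use nonneg in auto)
  qed
  have "profile_norm f (mat 1) = 1"
    using profile_norm_diag2[of 1 f] f by (simp add: diag2_1 profile_def)
  then show ?thesis
    using nonneg zero scale inv triangle
    unfolding normalized_ui_norms_def matrix_norm_def unitarily_invariant_def by blast
qed

lemma max_norm_eq_profile_norm:
  "(\<lambda>T::complex^2^2. max (t * operator_norm T) (trace_norm T)) = profile_norm (\<lambda>x. max t ((1 + x) / 2))"
proof
  fix T :: "complex^2^2"
  obtain U V a b where svd: "unitary_matrix U" "unitary_matrix V" "0 \<le> b" "b \<le> a"
    "T = U ** diag2 (of_real a) (of_real b) ** V"
    by (rule svd2)
  have "max (t * a) ((a + b) / 2) = a * max t ((1 + b / a) / 2)"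
  proof (cases "a = 0")
    case False
    then have "a * max t ((1 + b / a) / 2) = max (a * t) (a * ((1 + b / a) / 2))"
      using svd(3,4) by (simp add: max_mult_distrib_left)
    also have "a * ((1 + b / a) / 2) = (a + b) / 2" using False by (simp add: field_simps)
    finally show ?thesis by (simp add: mult.commute)
  qed (use svd in simp)
  then show "max (t * operator_norm T) (trace_norm T) = profile_norm (\<lambda>x. max t ((1 + x) / 2)) T"
    using svd by (simp add: operator_norm_svd trace_norm_svd profile_norm_svd)
qed

definition norm_profile :: "(complex^2^2 \<Rightarrow> real) \<Rightarrow> real \<Rightarrow> real"
  where "norm_profile N x = N (diag2 1 (of_real x))"

context
  fixes N :: "complex^2^2 \<Rightarrow> real"
  assumes N: "N \<in> normalized_ui_norms"
begin

lemma ui_norm_scale: "N (\<chi> i j. c * A $ i $ j) = cmod c * N A"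
  and ui_norm_triangle: "N (A + B) \<le> N A + N B"
  and ui_norm_invariant: "unitary_matrix U \<Longrightarrow> unitary_matrix V \<Longrightarrow> N (U ** A ** V) = N A"
  and ui_norm_one: "N (mat 1) = 1"
  using N by (auto simp: normalized_ui_norms_def matrix_norm_def unitarily_invariant_def)

lemma ui_norm_scale_diag2: "N (diag2 (c * a) (c * b)) = cmod c * N (diag2 a b)"
proof -
  have "diag2 (c * a) (c * b) = (\<chi> i j. c * diag2 a b $ i $ j)"
    by (rule matrix2_eqI) simp_all
  then show ?thesis by (simp only: ui_norm_scale)
qed

lemma ui_norm_add_diag2: "N (diag2 (a + c) (b + d)) \<le> N (diag2 a b) + N (diag2 c d)"
proof -
  have "diag2 (a + c) (b + d) = diag2 a b + diag2 c d"
    by (rule matrix2_eqI) simp_all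
  then show ?thesis by (simp only: ui_norm_triangle)
qed

lemma ui_norm_swap_diag2: "N (diag2 b a) = N (diag2 a b)"
proof -
  let ?S = "vector [vector [0, 1], vector [1, 0]] :: complex^2^2"
  have S: "unitary_matrix ?S"
    unfolding unitary_matrix_def
    by (intro conjI matrix2_eqI) (simp_all add: matrix2_mult_entry mat_def)
  have "diag2 b a = ?S ** diag2 a b ** ?S"
    by (rule matrix2_eqI) (simp_all add: matrix2_mult_entry)
  then show ?thesis using S by (simp only: ui_norm_invariant)
qed

lemma norm_profile_convex: "convex_on UNIV (norm_profile N)"
proof (rule convex_onI)
  fix s x y :: real
  assume s: "0 < s" "s < 1"
  let ?u = "of_real (1 - s) :: complex" and ?v = "of_real s :: complex"
  have "norm_profile N ((1 - s) *\<^sub>R x + s *\<^sub>R y) = N (diag2 (?u * 1 + ?v * 1) (?u * of_real x + ?v * of_real y))"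
    by (simp add: norm_profile_def)
  also have "\<dots> \<le> N (diag2 (?u * 1) (?u * of_real x)) + N (diag2 (?v * 1) (?v * of_real y))"
    by (rule ui_norm_add_diag2)
  also have "\<dots> = (1 - s) * norm_profile N x + s * norm_profile N y"
    using s unfolding ui_norm_scale_diag2 norm_of_real by (simp add: norm_profile_def)
  finally show "norm_profile N ((1 - s) *\<^sub>R x + s *\<^sub>R y) \<le> (1 - s) * norm_profile N x + s * norm_profile N y" .
qed simp

lemma norm_profile_minus: "norm_profile N (- x) = norm_profile N x"
proof -
  have "diag2 1 (of_real (- x)) = diag2 1 (- 1) ** diag2 1 (of_real x) ** mat 1"
    by (simp add: diag2_mult)
  then show ?thesis
    unfolding norm_profile_def by (simp only:) (rule ui_norm_invariant; simp add: unitary_diag2)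
qed

text \<open>The profile is even and convex on the whole real line, hence increasing on \<open>[0, 1]\<close>. The lower
  bound comes from \<open>diag (1, x) + diag (x, 1) = (1 + x) 1\<close>, whose summands are unitarily
  equivalent.\<close>

lemma profile_of_ui_norm: "profile (norm_profile N)"
  unfolding profile_def
proof (intro conjI ballI)
  show "convex_on {0..1} (norm_profile N)"
    using norm_profile_convex by (rule convex_on_subset) auto
  show one: "norm_profile N 1 = 1"
    by (simp add: norm_profile_def diag2_1 ui_norm_one)
  show "mono_on {0..1} (norm_profile N)"
  proof (rule mono_onI)
    fix x y :: real assume xy: "x \<in> {0..1}" "y \<in> {0..1}" "x \<le> y"
    show "norm_profile N x \<le> norm_profile N y"
    proof (cases "y = 0")
      case False
      (* the weight that expresses x as a convex combination of -y and y *)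
      define s where "s = (1 + x / y) / 2"
      have s: "0 \<le> s" "s \<le> 1" "x = (1 - s) * (- y) + s * y"
        using xy False by (auto simp: s_def field_simps)
      have "norm_profile N x \<le> (1 - s) * norm_profile N (- y) + s * norm_profile N y"
        using convex_onD[OF norm_profile_convex s(1,2), of "- y" y] s(3) by simp
      then show ?thesis by (simp add: norm_profile_minus algebra_simps)
    qed (use xy in simp)
  qed
  fix x :: real assume x: "x \<in> {0..1}"
  have "1 + x = cmod (of_real (1 + x)) * N (diag2 1 1)"
    using x unfolding norm_of_real by (simp add: diag2_1 ui_norm_one)
  also have "\<dots> = N (diag2 (1 + of_real x) (of_real x + 1))"
    by (simp flip: ui_norm_scale_diag2 add: add.commute)
  also have "\<dots> \<le> N (diag2 1 (of_real x)) + N (diag2 (of_real x) 1)"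
    by (rule ui_norm_add_diag2)
  also have "\<dots> = 2 * norm_profile N x"
    by (simp add: norm_profile_def ui_norm_swap_diag2[of "of_real x" 1])
  finally show "(1 + x) / 2 \<le> norm_profile N x" by simp
qed

lemma ui_norm_eq_profile_norm: "N = profile_norm (norm_profile N)"
proof
  fix T
  obtain U V a b where svd: "unitary_matrix U" "unitary_matrix V" "0 \<le> b" "b \<le> a"
    "T = U ** diag2 (of_real a) (of_real b) ** V"
    by (rule svd2)
  have "N T = N (diag2 (of_real a) (of_real b))"
    using svd by (simp add: ui_norm_invariant)
  also have "diag2 (of_real a) (of_real b) = diag2 (of_real a * 1) (of_real a * of_real (b / a))"
    using svd by (cases "a = 0") simp_all
  also have "N \<dots> = a * norm_profile N (b / a)"
    using svd unfolding ui_norm_scale_diag2 by (simp add: norm_profile_def)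
  finally show "N T = profile_norm (norm_profile N) T"
    using svd by (simp add: profile_norm_svd)
qed

end

section \<open>Extreme points\<close>

text \<open>A decomposition of the norm yields one of its profile, to which \<open>profile_max_extreme\<close> applies.\<close>

lemma max_norm_extreme:
  assumes t: "1/2 \<le> t" "t \<le> 1"
  shows "(\<lambda>T::complex^2^2. max (t * operator_norm T) (trace_norm T)) extreme_point_of normalized_ui_norms"
  unfolding max_norm_eq_profile_norm extreme_point_of_def
proof (intro conjI ballI notI)
  let ?f = "\<lambda>x. max t ((1 + x) / 2)"
  show "profile_norm ?f \<in> normalized_ui_norms"
    using t by (intro ui_norm_profile_norm profile_max)
  fix M N :: "complex^2^2 \<Rightarrow> real"
  assume M: "M \<in> normalized_ui_norms" and N: "N \<in> normalized_ui_norms"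
    and "profile_norm ?f \<in> open_segment M N"
  then obtain u where "M \<noteq> N" and u: "0 < u" "u < 1"
    and eq: "profile_norm ?f = (1 - u) *\<^sub>R M + u *\<^sub>R N"
    by (auto simp: in_segment)
  have "?f x = (1 - u) * norm_profile M x + u * norm_profile N x" if "x \<in> {0..1}" for x
    using fun_cong[OF eq, of "diag2 1 (of_real x)"] that
    by (simp add: profile_norm_diag2 norm_profile_def)
  then have "norm_profile M x = norm_profile N x" if "x \<in> {0..1}" for x
    using profile_max_extreme[OF profile_of_ui_norm[OF M] profile_of_ui_norm[OF N] u t] that
    by blast
  then have "profile_norm (norm_profile M) = profile_norm (norm_profile N)"
    by (intro profile_norm_eqI)
  with \<open>M \<noteq> N\<close> show False
    using ui_norm_eq_profile_norm[OF M] ui_norm_eq_profile_norm[OF N] by simp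
qed

text \<open>Both halves \<open>g\<close> and \<open>k\<close> of the split profile must coincide with \<open>f\<close>. But \<open>k\<close> is constant on
  \<open>[0, m]\<close> and \<open>g\<close> equals \<open>(1 + x) / 2\<close> on \<open>[m, 1]\<close>.\<close>

lemma extreme_is_max_norm:
  fixes N :: "complex^2^2 \<Rightarrow> real"
  assumes extr: "N extreme_point_of normalized_ui_norms"
  obtains t where "1/2 \<le> t" "t \<le> 1" "N = (\<lambda>T. max (t * operator_norm T) (trace_norm T))"
proof -
  have N: "N \<in> normalized_ui_norms" using extr by (simp add: extreme_point_of_def)
  define f where "f = norm_profile N"
  have f: "profile f" using profile_of_ui_norm[OF N] by (simp add: f_def)
  have Nf: "N = profile_norm f" using ui_norm_eq_profile_norm[OF N] by (simp add: f_def)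
  define h where "h = (\<lambda>x. 2 * f x - (1 + x) / 2)"
  (* A convex function on a compact interval may jump at the end points; this profile extends to a
     convex function on the whole line and is therefore continuous. *)
  have "continuous_on UNIV f"
    unfolding f_def by (intro convex_on_continuous norm_profile_convex N) simp
  then have "continuous_on {0..1} f"
    by (rule continuous_on_subset) simp
  then have "continuous_on {0..1} h"
    unfolding h_def by (intro continuous_intros) simp_all
  then obtain m where m: "m \<in> {0..1}" "\<And>x. x \<in> {0..1} \<Longrightarrow> h m \<le> h x"
    using continuous_attains_inf[of "{0..1::real}" h] by auto
  define g where "g = (\<lambda>x. (1 + x) / 2 + h (min x m) - h m)"
  define k where "k = (\<lambda>x. h (max x m))"
  have g: "profile g" and k: "profile k"
    using profile_split[OF f m(1)] m(2) unfolding g_def k_def h_def by blast+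
  have sum: "(1/2) * g x + (1/2) * k x = f x" for x
    by (auto simp: g_def k_def h_def min_def max_def field_simps)
  have mid: "N = (1 - 1/2) *\<^sub>R profile_norm g + (1/2) *\<^sub>R profile_norm k"
    by (rule ext) (simp add: Nf profile_norm_def sum[symmetric] algebra_simps)
  have "N \<in> open_segment (profile_norm g) (profile_norm k)" if "profile_norm g \<noteq> profile_norm k"
    unfolding in_segment by (intro conjI exI[of _ "1/2"] that mid) simp_all
  then have "profile_norm g = profile_norm k"
    using extr ui_norm_profile_norm[OF g] ui_norm_profile_norm[OF k]
    unfolding extreme_point_of_def by blast
  then have gk: "g x = k x" if "x \<in> {0..1}" for x
    using that by (metis profile_norm_diag2 atLeastAtMost_iff)
  have fg: "f x = g x" if "x \<in> {0..1}" for x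
    using sum[of x] gk[OF that] by simp
  have "f x = max ((1 + m) / 2) ((1 + x) / 2)" if x: "x \<in> {0..1}" for x
  proof -
    have "f m = (1 + m) / 2" using fg[OF m(1)] by (simp add: g_def)
    moreover have "f x = h m" if "x \<le> m"
      using fg[OF x] gk[OF x] that by (simp add: k_def max_def)
    moreover have "f x = (1 + x) / 2" if "m \<le> x"
      using fg[OF x] that by (simp add: g_def min_def)
    ultimately show ?thesis by (cases "x \<le> m") (auto simp: h_def max_def field_simps)
  qed
  then have "N = profile_norm (\<lambda>x. max ((1 + m) / 2) ((1 + x) / 2))"
    unfolding Nf by (intro profile_norm_eqI)
  then have "N = (\<lambda>T. max ((1 + m) / 2 * operator_norm T) (trace_norm T))"
    by (simp only: max_norm_eq_profile_norm)
  then show thesis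
    using m(1) by (intro that[of "(1 + m) / 2"]) auto
qed

theorem theoremJ:
  shows "{N. N extreme_point_of (normalized_ui_norms :: (complex^2^2 \<Rightarrow> real) set)} =
    {(\<lambda>T. max (t * operator_norm T) (trace_norm T)) | t::real. 1/2 \<le> t \<and> t \<le> 1}"
  using max_norm_extreme by (auto elim!: extreme_is_max_norm)

end
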